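(* Let $d\ge 1$ and let $\Pi=(\Sigma_{in},\Sigma_{out},t,\mathcal P)$ be an LCL on $\mathbb{Z}^d$. If $\Pi\in \mathsf{ULOCAL}(o(\log^* 1/\varepsilon))$, then $\Pi\in\mathsf{LOCAL}(O(1))$. In particular, if $\Sigma_{in}=\emptyset$, then $\Pi$ is trivial, meaning that there is $\alpha\in\Sigma_{out}$ such that the constant-$\alpha$ coloring is a $\Pi$-coloring.
   Context: Grid and LCLs. $\mathbb{Z}^d$ denotes the infinite grid: the Cayley graph of the group $\mathbb{Z}^d$ with respect to the standard generators, each edge being oriented and labelled by its generator (isomorphisms preserve this structure). $\mathcal B(v,r)$ is the ball of radius $r$ around $v$ in graph distance. A locally checkable problem (LCL) on $\mathbb{Z}^d$ is $\Pi=(\Sigma_{in},\Sigma_{out},t,\mathcal P)$, where $\Sigma_{in},\Sigma_{out}$ are finite sets, $t\in\mathbb N$, and $\mathcal P$ is a set of (isomorphism types of) rooted grids of radius $t$ with each vertex labelled by one label of $\Sigma_{in}$ and one of $\Sigma_{out}$. A labelling of the vertices of a graph by $\Sigma_{in}\times\Sigma_{out}$ is a $\Pi$-coloring if the $t$-hop neighborhood of every vertex is in $\mathcal P$. $\Sigma_{in}=\emptyset$ means there are no inputs. Uniform local algorithms. A uniform local algorithm is a pair $\mathcal A=(\mathcal C,f)$, where $\mathcal C$ is a collection of rooted finite-radius neighborhoods in $\mathbb{Z}^d$ with vertices labelled by $\Sigma_{in}$ and by reals in $[0,1]$, and $f:\mathcal C\to\Sigma_{out}$ is measurable. It is run on $\Sigma_{in}$-labelled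 $\mathbb{Z}^d$ whose vertices carry independent uniform labels from $[0,1]$: each vertex explores balls of radius $0,1,2,\dots$ around itself until the labelled ball lies in $\mathcal C$, and then outputs the value of $f$. The coding radius $R_{\mathcal A}$ is the minimal radius needed; $\mathrm P(R_{\mathcal A}>r)$ denotes the supremum over all $\Sigma_{in}$-labellings of $\mathcal B(v,r)$ of the probability that $v$ has to look further than $r$. $\mathcal A$ solves $\Pi$ if for every $\Sigma_{in}$-labelling it produces a $\Pi$-coloring with probability $1$. $\mathcal A$ has uniform complexity $t(\varepsilon)$ if $\mathrm P(R_{\mathcal A}>t(\varepsilon))\le\varepsilon$ for all sufficiently small $\varepsilon>0$. $\mathsf{ULOCAL}(t(\varepsilon))$ is the class of LCLs solved by a uniform local algorithm of uniform complexity $t(\varepsilon)$; $\mathsf{ULOCAL}(o(g))$ means complexity $t$ for some $t$ with $t(\varepsilon)/g(\varepsilon)\to0$ as $\varepsilon\to 0$. Local algorithms. A deterministic local algorithm of complexity $f(n)$ is a function taking $n$ and a rooted grid of radius $f(n)$ labelled by natural numbers (identifiers) and by $\Sigma_{in}$, and outputting a label from $\Sigma_{out}$. It is run on finite $d$-dimensional tori with $n$ vertices (side lengths $\Theta(n^{1/d})$, edges oriented and labelled by generators) whose vertices carry unique identifiers from $\{1,\dots,n^{O(1)}\}$ and input labels, by applying the function to the $f(n)$-hop neighborhood of every vertex. It solves $\Pi$ if it always produces a $\Pi$-coloring ($n$ large enough that the relevant balls of the torus are isomorphic to balls of $\mathbb{Z}^d$). $\mathsf{LOCAL}(f(n))$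 is the class of LCLs solved by such an algorithm of complexity $f(n)$. $\log^* x$ is the number of times $\log_2$ must be iterated, starting from $x$, to reach a value at most $1$. *)

theory Defs
  imports "HOL-Probability.Probability" "HOL-Library.Landau_Symbols"
begin

text \<open>
  The dimension \<open>d \<ge> 1\<close> is the cardinality of the index type \<open>'d\<close>; the vertices of the grid are the
  elements of \<open>int ^ 'd\<close>. Since edges are oriented and labelled by generators, the only isomorphism
  between a rooted ball around \<open>v\<close> and a rooted ball around \<open>0\<close> is the translation. Hence an
  isomorphism type of a labelled rooted grid of radius \<open>r\<close> is the same thing as an (extensional)
  labelling of the ball of radius \<open>r\<close> around \<open>0\<close>.
\<close>

definition hops :: "('v \<times> 'v) set \<Rightarrow> 'v \<Rightarrow> nat \<Rightarrow> 'v set" where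
  "hops E v r = {w. \<exists>k\<le>r. (v, w) \<in> E ^^ k}"

definition grid_adj :: "((int ^ 'd::finite) \<times> (int ^ 'd)) set" where
  "grid_adj = {(x, y). \<exists>i. y = x + axis i 1 \<or> x = y + axis i 1}"

definition grid_ball :: "int ^ 'd::finite \<Rightarrow> nat \<Rightarrow> (int ^ 'd) set" where
  "grid_ball v r = hops grid_adj v r"

definition grid_view :: "(int ^ 'd::finite \<Rightarrow> 'l) \<Rightarrow> int ^ 'd \<Rightarrow> nat \<Rightarrow> (int ^ 'd \<Rightarrow> 'l)" where
  "grid_view l v r = (\<lambda>u\<in>grid_ball 0 r. l (v + u))"


section \<open>Locally checkable problems\<close>

record ('a, 'b, 'd) lcl =
  in_labels :: "'a set"
  out_labels :: "'b set"
  radius :: nat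
  patterns :: "(int ^ 'd::finite \<Rightarrow> 'a option \<times> 'b) set"

text \<open>
  An empty set of input labels means that there are no inputs. This is encoded by giving every
  vertex the dummy label \<open>None\<close>; an actual input label \<open>a\<close> is represented by \<open>Some a\<close>.
\<close>

definition inputs :: "('a, 'b, 'd::finite) lcl \<Rightarrow> 'a option set" where
  "inputs L = (if in_labels L = {} then {None} else Some ` in_labels L)"

definition is_lcl :: "('a, 'b, 'd::finite) lcl \<Rightarrow> bool" where
  "is_lcl L \<longleftrightarrow> finite (in_labels L) \<and> finite (out_labels L) \<and>
     patterns L \<subseteq> (grid_ball 0 (radius L) \<rightarrow>\<^sub>E inputs L \<times> out_labels L)"

definition grid_coloring ::
  "('a, 'b, 'd::finite) lcl \<Rightarrow> (int ^ 'd \<Rightarrow> 'a option) \<Rightarrow> (int ^ 'd \<Rightarrow> 'b) \<Rightarrow> bool" where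
  "grid_coloring L x y \<longleftrightarrow> (\<forall>v. grid_view (\<lambda>w. (x w, y w)) v (radius L) \<in> patterns L)"

definition trivial_lcl :: "('a, 'b, 'd::finite) lcl \<Rightarrow> bool" where
  "trivial_lcl L \<longleftrightarrow> (\<exists>\<alpha>\<in>out_labels L. grid_coloring L (\<lambda>_. None) (\<lambda>_. \<alpha>))"


section \<open>Uniform local algorithms\<close>

definition unit_uniform :: "real measure" where
  "unit_uniform = restrict_space lborel {0..1}"

definition random_labels :: "(int ^ 'd::finite \<Rightarrow> real) measure" where
  "random_labels = (\<Pi>\<^sub>M v\<in>UNIV. unit_uniform)"

definition nbhd_space :: "('a, 'b, 'd::finite) lcl \<Rightarrow> nat \<Rightarrow> (int ^ 'd \<Rightarrow> 'a option \<times> real) measure" where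
  "nbhd_space L r = (\<Pi>\<^sub>M u\<in>grid_ball 0 r. count_space (inputs L) \<Otimes>\<^sub>M unit_uniform)"

text \<open>
  The collection of neighborhoods and the output function are split according to the radius of the
  neighborhood: \<open>stops A r\<close> is the set of those neighborhoods in the collection that have radius \<open>r\<close>.
\<close>

record ('a, 'b, 'd) ulocal_alg =
  stops :: "nat \<Rightarrow> (int ^ 'd::finite \<Rightarrow> 'a option \<times> real) set"
  decide :: "nat \<Rightarrow> (int ^ 'd \<Rightarrow> 'a option \<times> real) \<Rightarrow> 'b"

text \<open>
  The collection itself is required to be measurable, so that the events
  that the coding radius exceeds \<open>r\<close> are measurable.
\<close>

definition is_ulocal_alg :: "('a, 'b, 'd::finite) lcl \<Rightarrow> ('a, 'b, 'd) ulocal_alg \<Rightarrow> bool" where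
  "is_ulocal_alg L A \<longleftrightarrow>
     (\<forall>r. stops A r \<in> sets (nbhd_space L r) \<and>
          decide A r \<in> restrict_space (nbhd_space L r) (stops A r) \<rightarrow>\<^sub>M count_space (out_labels L))"

definition coding_radius ::
  "('a, 'b, 'd::finite) ulocal_alg \<Rightarrow> (int ^ 'd \<Rightarrow> 'a option \<times> real) \<Rightarrow> int ^ 'd \<Rightarrow> enat" where
  "coding_radius A l v = (INF r\<in>{r. grid_view l v r \<in> stops A r}. enat r)"

text \<open>Only meaningful if the coding radius at the vertex is finite.\<close>

definition ulocal_output ::
  "('a, 'b, 'd::finite) ulocal_alg \<Rightarrow> (int ^ 'd \<Rightarrow> 'a option \<times> real) \<Rightarrow> int ^ 'd \<Rightarrow> 'b" where
  "ulocal_output A l v =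
     (let r = the_enat (coding_radius A l v) in decide A r (grid_view l v r))"

definition ulocal_solves :: "('a, 'b, 'd::finite) lcl \<Rightarrow> ('a, 'b, 'd) ulocal_alg \<Rightarrow> bool" where
  "ulocal_solves L A \<longleftrightarrow>
     (\<forall>x \<in> UNIV \<rightarrow> inputs L. AE \<omega> in random_labels.
        (\<forall>v. coding_radius A (\<lambda>w. (x w, \<omega> w)) v < \<infinity>) \<and>
        grid_coloring L x (ulocal_output A (\<lambda>w. (x w, \<omega> w))))"

text \<open>
  The event below depends on \<open>x\<close> only through its values on the ball of radius \<open>r\<close> around \<open>v\<close>.
\<close>

definition prob_radius_greater ::
  "('a, 'b, 'd::finite) lcl \<Rightarrow> ('a, 'b, 'd) ulocal_alg \<Rightarrow> int ^ 'd \<Rightarrow> nat \<Rightarrow> real" where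
  "prob_radius_greater L A v r =
     (SUP x \<in> grid_ball v r \<rightarrow>\<^sub>E inputs L.
        measure random_labels
          {\<omega> \<in> space random_labels. coding_radius A (\<lambda>w. (x w, \<omega> w)) v > enat r})"

definition uniform_complexity ::
  "('a, 'b, 'd::finite) lcl \<Rightarrow> ('a, 'b, 'd) ulocal_alg \<Rightarrow> (real \<Rightarrow> nat) \<Rightarrow> bool" where
  "uniform_complexity L A t \<longleftrightarrow>
     (\<forall>\<^sub>F \<epsilon> in at_right 0. \<forall>v. prob_radius_greater L A v (t \<epsilon>) \<le> \<epsilon>)"

definition ULOCAL :: "(real \<Rightarrow> nat) \<Rightarrow> ('a, 'b, 'd::finite) lcl set" where
  "ULOCAL t = {L. is_lcl L \<and>
     (\<exists>A. is_ulocal_alg L A \<and> ulocal_solves L A \<and> uniform_complexity L A t)}"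

definition ULOCAL_o :: "(real \<Rightarrow> real) \<Rightarrow> ('a, 'b, 'd::finite) lcl set" where
  "ULOCAL_o g = (\<Union>t\<in>{t. (\<lambda>\<epsilon>. real (t \<epsilon>)) \<in> o[at_right 0](g)}. ULOCAL t)"

definition log_star :: "real \<Rightarrow> nat" where
  "log_star x = (LEAST k. (log 2 ^^ k) x \<le> 1)"


section \<open>Deterministic local algorithms on tori\<close>

text \<open>The torus with side lengths \<open>s\<close>; its vertices are represented by their reduced coordinates.\<close>

definition torus :: "nat ^ 'd::finite \<Rightarrow> (int ^ 'd) set" where
  "torus s = {v. \<forall>i. 0 \<le> v $ i \<and> v $ i < int (s $ i)}"

definition wrap :: "nat ^ 'd::finite \<Rightarrow> int ^ 'd \<Rightarrow> int ^ 'd" where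
  "wrap s v = (\<chi> i. v $ i mod int (s $ i))"

definition torus_adj :: "nat ^ 'd::finite \<Rightarrow> ((int ^ 'd) \<times> (int ^ 'd)) set" where
  "torus_adj s = {(x, y). x \<in> torus s \<and> y \<in> torus s \<and>
     (\<exists>i. y = wrap s (x + axis i 1) \<or> x = wrap s (y + axis i 1))}"

text \<open>
  All balls of radius \<open>r\<close> in the torus are isomorphic, as rooted graphs with oriented and labelled
  edges, to the ball of radius \<open>r\<close> in the grid. Such an isomorphism, if there is one, can only be the
  map \<open>u \<mapsto> v + u\<close>.
\<close>

definition torus_locally_grid :: "nat ^ 'd::finite \<Rightarrow> nat \<Rightarrow> bool" where
  "torus_locally_grid s r \<longleftrightarrow>
     (\<forall>v\<in>torus s.
        bij_betw (\<lambda>u. wrap s (v + u)) (grid_ball 0 r) (hops (torus_adj s) v r) \<and>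
        (\<forall>x\<in>grid_ball 0 r. \<forall>y\<in>grid_ball 0 r. \<forall>i.
           wrap s (v + y) = wrap s (v + x + axis i 1) \<longleftrightarrow> y = x + axis i 1))"

definition torus_view ::
  "nat ^ 'd::finite \<Rightarrow> (int ^ 'd \<Rightarrow> 'l) \<Rightarrow> int ^ 'd \<Rightarrow> nat \<Rightarrow> (int ^ 'd \<Rightarrow> 'l)" where
  "torus_view s l v r = (\<lambda>u\<in>grid_ball 0 r. l (wrap s (v + u)))"

definition torus_coloring ::
  "('a, 'b, 'd::finite) lcl \<Rightarrow> nat ^ 'd \<Rightarrow> (int ^ 'd \<Rightarrow> 'a option) \<Rightarrow> (int ^ 'd \<Rightarrow> 'b) \<Rightarrow> bool" where
  "torus_coloring L s x y \<longleftrightarrow>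
     (\<forall>v\<in>torus s. torus_view s (\<lambda>w. (x w, y w)) v (radius L) \<in> patterns L)"

type_synonym ('a, 'b, 'd) local_alg = "nat \<Rightarrow> (int ^ 'd \<Rightarrow> nat \<times> 'a option) \<Rightarrow> 'b"

definition is_local_alg ::
  "('a, 'b, 'd::finite) lcl \<Rightarrow> (nat \<Rightarrow> nat) \<Rightarrow> ('a, 'b, 'd) local_alg \<Rightarrow> bool" where
  "is_local_alg L f A \<longleftrightarrow>
     (\<forall>n. A n \<in> (grid_ball 0 (f n) \<rightarrow>\<^sub>E UNIV \<times> inputs L) \<rightarrow> out_labels L)"

text \<open>
  The constants \<open>c\<close> and \<open>k\<close> are those hidden in the side lengths being of order \<open>n powr (1 / d)\<close>
  and in the identifiers being polynomially bounded: the algorithm has to succeed for every choice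
  of them.
\<close>

definition local_solves ::
  "('a, 'b, 'd::finite) lcl \<Rightarrow> (nat \<Rightarrow> nat) \<Rightarrow> ('a, 'b, 'd) local_alg \<Rightarrow> bool" where
  "local_solves L f A \<longleftrightarrow>
     (\<forall>(c::real) (k::nat) (n::nat) (s::nat ^ 'd) ident x.
        c \<ge> 1 \<longrightarrow>
        n = (\<Prod>i\<in>UNIV. s $ i) \<longrightarrow> n \<ge> 1 \<longrightarrow>
        (\<forall>i. real n powr (1 / real CARD('d)) / c \<le> real (s $ i) \<and>
             real (s $ i) \<le> c * real n powr (1 / real CARD('d))) \<longrightarrow>
        torus_locally_grid s (f n) \<longrightarrow> torus_locally_grid s (radius L) \<longrightarrow>
        inj_on ident (torus s) \<longrightarrow> ident \<in> torus s \<rightarrow> {1..n ^ k} \<longrightarrow>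
        x \<in> torus s \<rightarrow> inputs L \<longrightarrow>
        torus_coloring L s x (\<lambda>v. A n (torus_view s (\<lambda>w. (ident w, x w)) v (f n))))"

definition LOCAL :: "(nat \<Rightarrow> nat) \<Rightarrow> ('a, 'b, 'd::finite) lcl set" where
  "LOCAL f = {L. is_lcl L \<and> (\<exists>A. is_local_alg L f A \<and> local_solves L f A)}"

definition LOCAL_O :: "(nat \<Rightarrow> real) \<Rightarrow> ('a, 'b, 'd::finite) lcl set" where
  "LOCAL_O g = (\<Union>f\<in>{f. (\<lambda>n. real (f n)) \<in> O(g)}. LOCAL f)"

end

theory Submission
  imports Defs
begin

text \<open>
  Let \<open>T = t(\<epsilon>)\<close> and write identifiers as \<open>d\<close>-tuples of numbers below \<open>N\<close>. By a union bound one fixed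
  assignment of reals to identifiers makes the algorithm succeed within radius \<open>T\<close> on every input
  labelling of a ball of radius \<open>T\<close> plus a constant whose vertex \<open>v\<close> has the identifier
  \<open>(a\<^sub>1(v\<^sub>1), \<dots>, a\<^sub>d(v\<^sub>d))\<close> for increasing sequences \<open>a\<^sub>1, \<dots>, a\<^sub>d\<close>. The rule applied at a vertex then
  depends on \<open>d\<close> windows of length \<open>2T + 1\<close> only, rather than on all identifiers in the ball.
  Linial's argument on the shift graph, applied to one coordinate after the other, gives sequences
  on which all nearby vertices apply the same rule, and this rule ignores identifiers. Both steps
  are possible together if \<open>1/\<epsilon>\<close> exceeds a tower of twos of height \<open>O(T)\<close>, which holds for some \<open>\<epsilon>\<close> as
  \<open>T = o(log\<^sup>* 1/\<epsilon>)\<close>.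
\<close>

section \<open>Towers and the iterated logarithm\<close>

text \<open>Every count is rounded up to a value of \<open>twr\<close>, so that a sum, product or
  power costs one, two or three levels and only the height of the tower has to be tracked.\<close>

fun twr :: "nat \<Rightarrow> nat" where
  "twr 0 = 1"
| "twr (Suc n) = 2 ^ twr n"

lemma twr_ge_1: "1 \<le> twr n"
  by (cases n) auto

lemma le_twr: "n \<le> twr n"
proof (induction n)
  case (Suc n)
  have "twr n < 2 ^ twr n" by (rule less_exp)
  with Suc show ?case by (simp only: twr.simps)
qed simp

lemma twr_mono: "m \<le> n \<Longrightarrow> twr m \<le> twr n"
proof (induction n rule: dec_induct)
  case (step n)
  have "twr n < 2 ^ twr n" by (rule less_exp)
  with step show ?case by (simp only: twr.simps)
qed simp

lemma add_le_twr:
  assumes "a \<le> twr n" "b \<le> twr n"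
  shows "a + b \<le> twr (n + 1)"
proof -
  have "2 * x \<le> 2 ^ x" if "1 \<le> x" for x :: nat
    using that
  proof (induction x rule: dec_induct)
    case (step x)
    then show ?case using less_exp[of x] by simp
  qed simp
  from this[OF twr_ge_1[of n]] show ?thesis
    using assms by simp
qed

lemma mult_le_twr:
  assumes "a \<le> twr n" "b \<le> twr n"
  shows "a * b \<le> twr (n + 2)"
proof -
  have "a * b \<le> 2 ^ a * 2 ^ b"
    by (intro mult_mono) (auto intro: less_imp_le less_exp)
  also have "\<dots> = 2 ^ (a + b)" by (simp add: power_add)
  also have "\<dots> \<le> 2 ^ twr (n + 1)"
    using add_le_twr[OF assms] by (intro power_increasing) auto
  finally show ?thesis by simp
qed

lemma power_le_twr:
  assumes "a \<le> twr n" "b \<le> twr n"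
  shows "a ^ b \<le> twr (n + 3)"
proof -
  have "a ^ b \<le> (2 ^ a) ^ b"
    by (intro power_mono) (auto intro: less_imp_le less_exp)
  also have "\<dots> = 2 ^ (a * b)" by (simp add: power_mult)
  also have "\<dots> \<le> 2 ^ twr (n + 2)"
    using mult_le_twr[OF assms] by (intro power_increasing) auto
  finally show ?thesis by (simp add: eval_nat_numeral)
qed

declare twr.simps [simp del]

text \<open>Each logarithm removes one level of the tower. The count is some
  \<open>k \<le> n\<close> because the iteration has to stop once it is at most 1, before the
  logarithm meets nonpositive arguments.\<close>

lemma log_iterate_le_1:
  assumes "x \<le> real (twr n)"
  shows "\<exists>k\<le>n. (log 2 ^^ k) x \<le> 1"
  using assms
proof (induction n arbitrary: x)
  case 0
  then show ?case by (simp add: twr.simps)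
next
  case (Suc n)
  show ?case
  proof (cases "x \<le> 1")
    case False
    then have "log 2 x \<le> real (twr n)"
      using Suc.prems by (simp add: log_le_iff powr_realpow twr.simps)
    then obtain k where "k \<le> n" "(log 2 ^^ k) (log 2 x) \<le> 1"
      using Suc.IH by blast
    then show ?thesis
      by (intro exI[of _ "Suc k"]) (simp add: funpow_Suc_right del: funpow.simps)
  qed (intro exI[of _ 0], simp)
qed

lemma le_twr_imp_log_star_le:
  assumes "x \<le> real (twr n)"
  shows "log_star x \<le> n"
  using log_iterate_le_1[OF assms] unfolding log_star_def by (meson Least_le le_trans)

lemma twr_less_imp_log_star_gr:
  assumes "real (twr n) < x"
  shows "n < log_star x"
proof -
  have *: "real (twr (n - k)) < (log 2 ^^ k) x" if "k \<le> n" for k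
    using that
  proof (induction k)
    case (Suc k)
    then have "real (twr (n - k)) < (log 2 ^^ k) x" by simp
    moreover have "twr (n - k) = 2 ^ twr (n - Suc k)"
      using Suc.prems by (metis Suc_diff_Suc Suc_le_lessD twr.simps(2))
    ultimately have "2 ^ twr (n - Suc k) < (log 2 ^^ k) x" by simp
    then have "real (twr (n - Suc k)) < log 2 ((log 2 ^^ k) x)"
      by (subst less_log_iff) (auto simp: powr_realpow intro: le_less_trans[rotated])
    then show ?case by simp
  qed (use assms in simp)
  \<comment> \<open>\<open>log_star\<close> is a \<open>LEAST\<close>, so some iterate that is at
    most 1 must exist before it has its defining property.\<close>
  obtain m where "x \<le> real m" using real_arch_simple by blast
  then have "x \<le> real (twr m)" using le_twr[of m] by linarith
  then have "\<exists>k. (log 2 ^^ k) x \<le> 1" using log_iterate_le_1 by blast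
  then have "(log 2 ^^ log_star x) x \<le> 1"
    unfolding log_star_def by (rule LeastI_ex)
  moreover have "1 < (log 2 ^^ k) x" if "k \<le> n" for k
    using *[OF that] twr_ge_1[of "n - k"] by linarith
  ultimately show ?thesis by (meson not_le)
qed

text \<open>This makes any additive constant in a tower height negligible against the log-star of
  \<open>1 / \<epsilon>\<close>.\<close>

lemma filterlim_log_star: "filterlim (\<lambda>\<epsilon>. real (log_star (1 / \<epsilon>))) at_top (at_right 0)"
proof -
  have "filterlim log_star at_top at_top"
    unfolding filterlim_at_top
  proof
    fix n
    show "\<forall>\<^sub>F x in at_top. n \<le> log_star x"
      using eventually_gt_at_top[of "real (twr n)"]
      by eventually_elim (auto dest: twr_less_imp_log_star_gr)
  qed
  then have "filterlim (\<lambda>x. real (log_star x)) at_top at_top"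
    by (rule filterlim_compose[OF filterlim_real_sequentially])
  then show ?thesis
    by (rule filterlim_compose)
      (simp add: divide_inverse filterlim_inverse_at_top_right)
qed

section \<open>Windows of increasing lists\<close>

text \<open>These are the vertices of the shift graph; two of them are adjacent when they are the
  successive windows of an increasing list that is longer by one.\<close>

definition inc_lists :: "nat \<Rightarrow> nat \<Rightarrow> nat list set" where
  "inc_lists N p = {xs. sorted_wrt (<) xs \<and> set xs \<subseteq> {..<N} \<and> length xs = p}"

definition window :: "nat \<Rightarrow> nat \<Rightarrow> 'a list \<Rightarrow> 'a list" where
  "window p j xs = take p (drop j xs)"

lemma inc_lists_subset: "inc_lists N p \<subseteq> {xs. set xs \<subseteq> {..<N} \<and> length xs = p}"
  by (auto simp: inc_lists_def)

lemma finite_inc_lists: "finite (inc_lists N p)"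
  by (rule finite_subset[OF inc_lists_subset]) (simp add: finite_lists_length_eq)

lemma card_inc_lists: "card (inc_lists N p) \<le> N ^ p"
  using card_mono[OF _ inc_lists_subset, of N p]
  by (simp add: finite_lists_length_eq card_lists_length_eq)

lemma inc_lists_mono: "M \<le> N \<Longrightarrow> inc_lists M p \<subseteq> inc_lists N p"
  by (fastforce simp: inc_lists_def)

lemma window_inc_lists:
  assumes "l \<in> inc_lists N q" "j + p \<le> q"
  shows "window p j l \<in> inc_lists N p"
  using assms set_take_subset[of p "drop j l"] set_drop_subset[of j l]
  by (auto simp: inc_lists_def window_def intro!: sorted_wrt_take sorted_wrt_drop)

lemma window_window:
  "j + p \<le> q \<Longrightarrow> window p j (window q i l) = window p (i + j) l"
  by (simp add: window_def drop_take min_def add.commute)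

section \<open>Colourings of the shift graph\<close>

text \<open>Replacing the colour of a list by the set of colours of its extensions shortens
  the lists by one and exponentiates the number of colours.\<close>

lemma shift_graph_collision:
  assumes "\<kappa> \<in> inc_lists N (Suc p) \<rightarrow> {..<c}" "c \<le> twr n" "twr (n + p) < N"
  shows "\<exists>l\<in>inc_lists N (Suc (Suc p)). \<kappa> (window (Suc p) 0 l) = \<kappa> (window (Suc p) 1 l)"
  using assms
proof (induction p arbitrary: \<kappa> c n)
  case 0
  have "\<not> inj_on (\<lambda>x. \<kappa> [x]) {..<N}"
  proof
    assume "inj_on (\<lambda>x. \<kappa> [x]) {..<N}"
    moreover have "(\<lambda>x. \<kappa> [x]) ` {..<N} \<subseteq> {..<c}"
      using 0(1) by (auto simp: inc_lists_def Pi_iff)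
    ultimately have "card {..<N} \<le> card {..<c}"
      by (intro card_inj_on_le) auto
    with 0 show False by simp
  qed
  then obtain x y where "x < y" "y < N" "\<kappa> [x] = \<kappa> [y]"
    unfolding inj_on_def by (metis lessThan_iff linorder_neqE_nat)
  then show ?case
    by (intro bexI[of _ "[x, y]"]) (auto simp: inc_lists_def window_def)
next
  case (Suc p)
  \<comment> \<open>\<open>g\<close> encodes sets of colours as numbers below \<open>2 ^ c\<close>,
    as the induction hypothesis asks. One more level for the colours and one element less in the
    lists leave the bound on \<open>N\<close> unchanged.\<close>
  obtain g where g: "bij_betw g (Pow {..<c}) {0..<card (Pow {..<c})}"
    using ex_bij_betw_finite_nat by blast
  define S where "S l = \<kappa> ` {l @ [y] | y. l @ [y] \<in> inc_lists N (Suc (Suc p))}" for l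
  have S: "S l \<in> Pow {..<c}" for l
    using Suc.prems(1) unfolding S_def by blast
  have "g (S l) < 2 ^ c" for l
    using bij_betwE[OF g] S[of l] by (auto simp: card_Pow)
  moreover have "2 ^ c \<le> twr (Suc n)"
    using Suc.prems(2) by (simp add: twr.simps)
  ultimately have "\<exists>l\<in>inc_lists N (Suc (Suc p)). g (S (window (Suc p) 0 l)) = g (S (window (Suc p) 1 l))"
    using Suc.prems(3) by (intro Suc.IH[of _ "2 ^ c" "Suc n"]) auto
  then obtain l where l: "l \<in> inc_lists N (Suc (Suc p))"
    and "g (S (window (Suc p) 0 l)) = g (S (window (Suc p) 1 l))" by blast
  then have eq: "S (window (Suc p) 0 l) = S (window (Suc p) 1 l)"
    using S g by (meson bij_betw_imp_inj_on inj_onD)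
  have len: "length l = Suc (Suc p)" using l by (simp add: inc_lists_def)
  have "l = window (Suc p) 0 l @ [last l]"
    using len by (metis append_butlast_last_id butlast_conv_take diff_Suc_1 drop0 length_0_conv
        nat.distinct(1) window_def)
  \<comment> \<open>\<open>\<kappa> l\<close> is the colour of an extension of the first window,
    hence also of some extension \<open>tl l @ [y]\<close> of the second.\<close>
  with l have "\<kappa> l \<in> S (window (Suc p) 0 l)"
    unfolding S_def by (metis (mono_tags, lifting) image_eqI mem_Collect_eq)
  then obtain y where y: "tl l @ [y] \<in> inc_lists N (Suc (Suc p))" "\<kappa> (tl l @ [y]) = \<kappa> l"
    using eq len by (auto simp: S_def window_def drop_Suc)
  \<comment> \<open>The overlap \<open>b # r\<close> is nonempty, so \<open>a < b < y\<close> makes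
    \<open>l @ [y]\<close> increasing.\<close>
  from len obtain a b r where abr: "l = a # b # r"
    by (auto simp: length_Suc_conv)
  with l y(1) have "l @ [y] \<in> inc_lists N (Suc (Suc (Suc p)))"
    by (auto simp: inc_lists_def sorted_wrt_append)
  moreover have "window (Suc (Suc p)) 0 (l @ [y]) = l" "window (Suc (Suc p)) 1 (l @ [y]) = tl l @ [y]"
    using len by (simp_all add: window_def abr)
  ultimately show ?case using y(2) by metis
qed

text \<open>If no run of equal colours has length \<open>k + 1\<close>, then pairing the colour with the distance
  to the next colour change gives a proper colouring of the shift graph.\<close>

lemma shift_graph_run:
  assumes \<kappa>: "\<kappa> \<in> inc_lists N (Suc p) \<rightarrow> C" and C: "finite C" "card C * Suc k \<le> twr n"
    and N: "twr (n + p + k) < N"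
  shows "\<exists>l\<in>inc_lists N (Suc p + k). \<forall>j\<le>k. \<kappa> (window (Suc p) j l) = \<kappa> (window (Suc p) 0 l)"
proof (rule ccontr)
  assume neg: "\<not> ?thesis"
  let ?P = "\<lambda>l j. \<kappa> (window (Suc p) j l) \<noteq> \<kappa> (window (Suc p) 0 l)"
  have ex: "\<exists>j\<le>k. ?P l j" if "l \<in> inc_lists N (Suc p + k)" for l
    using neg that by blast
  define \<delta> where "\<delta> l = (LEAST j. ?P l j)" for l
  have \<delta>: "?P l (\<delta> l)" "\<delta> l \<le> k" if l: "l \<in> inc_lists N (Suc p + k)" for l
  proof -
    obtain j where j: "j \<le> k" "?P l j" using ex[OF l] by blast
    show "?P l (\<delta> l)" unfolding \<delta>_def by (rule LeastI[of _ j]) (rule j(2))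
    show "\<delta> l \<le> k" using Least_le[of "?P l" j] j by (simp add: \<delta>_def)
  qed
  let ?D = "C \<times> {..k}"
  obtain g where g: "bij_betw g ?D {0..<card ?D}"
    using ex_bij_betw_finite_nat[of ?D] C(1) by auto
  define \<psi> where "\<psi> l = (\<kappa> (window (Suc p) 0 l), \<delta> l)" for l
  have \<psi>: "\<psi> l \<in> ?D" if "l \<in> inc_lists N (Suc p + k)" for l
    using that \<kappa> \<delta>(2)[OF that] window_inc_lists[OF that, of 0 "Suc p"] by (auto simp: \<psi>_def)
  \<comment> \<open>\<open>\<delta>\<close> inspects windows at offsets up to \<open>k\<close>, so
    the new colouring lives on lists of length \<open>Suc p + k\<close>.\<close>
  have "(\<lambda>l. g (\<psi> l)) \<in> inc_lists N (Suc (p + k)) \<rightarrow> {..<card ?D}"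
  proof
    fix l assume "l \<in> inc_lists N (Suc (p + k))"
    then have "\<psi> l \<in> ?D" by (intro \<psi>) (simp only: add_Suc)
    from bspec[OF bij_betwE[OF g] this] show "g (\<psi> l) \<in> {..<card ?D}"
      by (simp only: atLeastLessThan_iff lessThan_iff)
  qed
  moreover have "card ?D \<le> twr n" using C by simp
  moreover have "twr (n + (p + k)) < N" using N by (simp only: add.assoc)
  ultimately have "\<exists>l\<in>inc_lists N (Suc (Suc (p + k))).
      g (\<psi> (window (Suc (p + k)) 0 l)) = g (\<psi> (window (Suc (p + k)) 1 l))"
    by (rule shift_graph_collision)
  then obtain l where l: "l \<in> inc_lists N (Suc (Suc (p + k)))"
    and eq: "g (\<psi> (window (Suc (p + k)) 0 l)) = g (\<psi> (window (Suc (p + k)) 1 l))" ..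
  define l0 where "l0 = window (Suc (p + k)) 0 l"
  define l1 where "l1 = window (Suc (p + k)) 1 l"
  have in01: "l0 \<in> inc_lists N (Suc p + k)" "l1 \<in> inc_lists N (Suc p + k)"
    unfolding l0_def l1_def add_Suc by (rule window_inc_lists[OF l]; simp)+
  have "\<psi> l0 = \<psi> l1"
    using inj_onD[OF bij_betw_imp_inj_on[OF g], of "\<psi> l0" "\<psi> l1"] \<psi>[OF in01(1)] \<psi>[OF in01(2)] eq
    by (simp add: l0_def l1_def)
  then have same: "\<kappa> (window (Suc p) 0 l0) = \<kappa> (window (Suc p) 0 l1)" "\<delta> l0 = \<delta> l1"
    by (auto simp: \<psi>_def)
  have w1: "window (Suc p) j l1 = window (Suc p) (Suc j) l0" if "j < k" for j
    unfolding l0_def l1_def using that by (subst (1 2) window_window) auto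
  \<comment> \<open>The window of \<open>l1\<close> at offset \<open>j\<close> is that of
    \<open>l0\<close> at \<open>Suc j\<close>. Since both lists start with the same colour, the
    change is one step closer in \<open>l1\<close>, against
    \<open>\<delta> l0 = \<delta> l1\<close>.\<close>
  have "\<delta> l0 \<noteq> 0" using \<delta>(1)[OF in01(1)] by (metis)
  then obtain j where j: "\<delta> l0 = Suc j" by (cases "\<delta> l0") auto
  have "?P l1 j"
    using \<delta>[OF in01(1)] same(1) w1[of j] j by simp
  then have "\<delta> l1 \<le> j" unfolding \<delta>_def by (rule Least_le)
  with same j show False by simp
qed

text \<open>The coordinates are treated one at a time. For a new coordinate \<open>a\<close>, the
  colour of a window is the map from the windows in the other coordinates to their joint colour;
  along a run of that colour the offset in \<open>a\<close> does not matter, and induction handles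
  the others. The price is \<open>p + k + 10\<close> tower levels per coordinate.\<close>

lemma shift_graph_grid:
  fixes \<kappa> :: "('i \<Rightarrow> nat list) \<Rightarrow> 'c"
  assumes "finite I" "\<kappa> \<in> (I \<rightarrow>\<^sub>E inc_lists N (Suc p)) \<rightarrow> C" "finite C"
    and "card C \<le> twr n" "Suc k \<le> twr n" "Suc p \<le> twr n" "card I \<le> twr n"
    and "twr (n + card I * (p + k + 10)) < N"
  shows "\<exists>l\<in>I \<rightarrow>\<^sub>E inc_lists N (Suc p + k). \<exists>c. \<forall>s\<in>I \<rightarrow> {..k}.
    \<kappa> (\<lambda>i\<in>I. window (Suc p) (s i) (l i)) = c"
  using assms(1,2,7,8)
proof (induction I arbitrary: \<kappa> N rule: finite_induct)
  case empty
  show ?case by (auto simp: PiE_empty_domain)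
next
  case (insert a I)
  define m where "m = n + card I * (p + k + 10)"
  have nm: "twr n \<le> twr m" by (rule twr_mono) (simp add: m_def)
  \<comment> \<open>\<open>M\<close> is the least alphabet size to which the induction hypothesis
    applies. Keeping the other coordinates below \<open>M\<close>, not \<open>N\<close>, makes the
    number of colours small compared with \<open>N\<close>.\<close>
  define M where "M = Suc (twr m)"
  let ?W = "I \<rightarrow>\<^sub>E inc_lists M (Suc p)"
  have N: "twr (m + 10 + p + k) < N"
    using insert.prems(3) insert.hyps by (simp add: m_def algebra_simps)
  have "twr (m + 1) \<le> twr (m + 10 + p + k)" by (rule twr_mono) simp
  moreover have M1: "M \<le> twr (m + 1)"
    using less_exp[of "twr m"] by (simp add: M_def Suc_le_eq twr.simps)
  ultimately have MN: "M \<le> N" using N by simp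
  have finW: "finite ?W" using insert.hyps finite_inc_lists by (intro finite_PiE) auto
  define \<kappa>' where "\<kappa>' w = (\<lambda>f\<in>?W. \<kappa> (f(a := w)))" for w
  have upd: "f(a := w) \<in> insert a I \<rightarrow>\<^sub>E inc_lists N (Suc p)"
    if "f \<in> ?W" "w \<in> inc_lists N (Suc p)" for f w
    using that inc_lists_mono[OF MN] by (intro PiE_I) (auto simp: PiE_iff extensional_def)
  have mem: "\<kappa>' \<in> inc_lists N (Suc p) \<rightarrow> (?W \<rightarrow>\<^sub>E C)"
  proof
    fix w assume w: "w \<in> inc_lists N (Suc p)"
    show "\<kappa>' w \<in> ?W \<rightarrow>\<^sub>E C"
      unfolding \<kappa>'_def using funcset_mem[OF insert.prems(1) upd[OF _ w]]
      by (intro restrict_PiE_iff[THEN iffD2]) blast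
  qed
  \<comment> \<open>The heights are \<open>m + 5\<close> for the tuples in \<open>?W\<close>,
    \<open>m + 8\<close> for the functions on them, and \<open>m + 10\<close> after the factor
    \<open>Suc k\<close> from \<open>shift_graph_run\<close>.\<close>
  have "card ?W = card (inc_lists M (Suc p)) ^ card I"
    using insert.hyps by (simp add: card_PiE)
  also have "\<dots> \<le> (M ^ Suc p) ^ card I"
    by (intro power_mono card_inc_lists) auto
  also have "\<dots> = M ^ (Suc p * card I)" by (simp only: power_mult)
  also have "\<dots> \<le> twr (m + 2 + 3)"
  proof (rule power_le_twr)
    show "M \<le> twr (m + 2)" using M1 twr_mono[of "m + 1" "m + 2"] by linarith
    have "card I \<le> twr n" using insert.prems(2) insert.hyps by simp
    then show "Suc p * card I \<le> twr (m + 2)"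
      using assms(6) nm by (intro mult_le_twr) linarith+
  qed
  finally have cW: "card ?W \<le> twr (m + 5)" by (simp add: add.commute)
  have "card (?W \<rightarrow>\<^sub>E C) = card C ^ card ?W"
    using finW by (simp add: card_PiE)
  also have "\<dots> \<le> twr (m + 5 + 3)"
    using cW assms(4) nm twr_mono[of m "m + 5"] by (intro power_le_twr) linarith+
  finally have "card (?W \<rightarrow>\<^sub>E C) \<le> twr (m + 8)" by (simp add: add.commute)
  then have "card (?W \<rightarrow>\<^sub>E C) * Suc k \<le> twr (m + 8 + 2)"
    using assms(5) nm twr_mono[of m "m + 8"] by (intro mult_le_twr) linarith+
  then have cCk: "card (?W \<rightarrow>\<^sub>E C) * Suc k \<le> twr (m + 10)" by (simp add: add.commute)
  have fin: "finite (?W \<rightarrow>\<^sub>E C)" using assms(3) by (intro finite_PiE finW) auto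
  have "\<exists>l\<in>inc_lists N (Suc p + k). \<forall>j\<le>k. \<kappa>' (window (Suc p) j l) = \<kappa>' (window (Suc p) 0 l)"
    using fin cCk N by (rule shift_graph_run[OF mem])
  then obtain l where l: "l \<in> inc_lists N (Suc p + k)"
    and run: "\<forall>j\<le>k. \<kappa>' (window (Suc p) j l) = \<kappa>' (window (Suc p) 0 l)" ..
  let ?w = "window (Suc p) 0 l"
  have w: "?w \<in> inc_lists N (Suc p)" by (rule window_inc_lists[OF l]) simp
  have "\<exists>l\<in>I \<rightarrow>\<^sub>E inc_lists M (Suc p + k). \<exists>c. \<forall>s\<in>I \<rightarrow> {..k}.
    \<kappa>' ?w (\<lambda>i\<in>I. window (Suc p) (s i) (l i)) = c"
  proof (rule insert.IH)
    show "\<kappa>' ?w \<in> ?W \<rightarrow> C" using PiE_mem[OF funcset_mem[OF mem w]] by (rule Pi_I)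
    show "card I \<le> twr n" using insert.prems(2) insert.hyps by simp
    show "twr (n + card I * (p + k + 10)) < M" by (simp only: M_def m_def lessI)
  qed
  then obtain L c where L: "L \<in> I \<rightarrow>\<^sub>E inc_lists M (Suc p + k)"
    and Lc: "\<And>s. s \<in> I \<rightarrow> {..k} \<Longrightarrow> \<kappa>' ?w (\<lambda>i\<in>I. window (Suc p) (s i) (L i)) = c"
    by blast
  have "L(a := l) \<in> insert a I \<rightarrow>\<^sub>E inc_lists N (Suc p + k)"
    using L l inc_lists_mono[OF MN] by (intro PiE_I) (auto simp: PiE_iff extensional_def)
  moreover have "\<forall>s\<in>insert a I \<rightarrow> {..k}.
    \<kappa> (\<lambda>i\<in>insert a I. window (Suc p) (s i) ((L(a := l)) i)) = c"
  proof
    fix s assume s: "s \<in> insert a I \<rightarrow> {..k}"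
    let ?f = "\<lambda>i\<in>I. window (Suc p) (s i) (L i)"
    have f: "?f \<in> ?W"
    proof (intro restrict_PiE_iff[THEN iffD2] ballI)
      fix i assume i: "i \<in> I"
      have "s i \<le> k" using s i by auto
      then show "window (Suc p) (s i) (L i) \<in> inc_lists M (Suc p)"
        using PiE_mem[OF L i] by (intro window_inc_lists[of _ _ "Suc p + k"]) simp_all
    qed
    have "(\<lambda>i\<in>insert a I. window (Suc p) (s i) ((L(a := l)) i)) = ?f(a := window (Suc p) (s a) l)"
      using insert.hyps(2) by (simp add: fun_eq_iff restrict_def)
    then have "\<kappa> (\<lambda>i\<in>insert a I. window (Suc p) (s i) ((L(a := l)) i))
        = \<kappa>' (window (Suc p) (s a) l) ?f"
      by (simp only: \<kappa>'_def restrict_apply'[OF f])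
    also have "\<dots> = \<kappa>' ?w ?f"
    proof (rule arg_cong[of _ _ "\<lambda>h. h ?f"])
      have "s a \<le> k" using s by auto
      with run show "\<kappa>' (window (Suc p) (s a) l) = \<kappa>' ?w" by blast
    qed
    also have "\<dots> = c" using s by (intro Lc) auto
    finally show "\<kappa> (\<lambda>i\<in>insert a I. window (Suc p) (s i) ((L(a := l)) i)) = c" .
  qed
  ultimately show ?case by (intro bexI[of _ "L(a := l)"] exI[of _ c])
qed

section \<open>Balls and coding radii\<close>

lemma relpow_grid_adj_bound:
  "(x, y) \<in> grid_adj ^^ k \<Longrightarrow> \<bar>y $ i - x $ i\<bar> \<le> int k"
proof (induction k arbitrary: y)
  case (Suc k)
  then obtain z where z: "(x, z) \<in> grid_adj ^^ k" "(z, y) \<in> grid_adj" by auto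
  have "\<bar>y $ i - z $ i\<bar> \<le> 1"
    using z(2) by (auto simp: grid_adj_def axis_def)
  with Suc.IH[OF z(1)] show ?case by simp
qed simp

lemma relpow_grid_adj_translate:
  "(x, y) \<in> grid_adj ^^ k \<Longrightarrow> (v + x, v + y) \<in> grid_adj ^^ k"
proof (induction k arbitrary: y)
  case (Suc k)
  then obtain z where z: "(x, z) \<in> grid_adj ^^ k" "(z, y) \<in> grid_adj" by auto
  have "(v + z, v + y) \<in> grid_adj"
    using z(2) by (auto simp: grid_adj_def add.assoc)
  with Suc.IH[OF z(1)] show ?case by auto
qed simp

text \<open>The ball of the maximum norm around 0. It contains the graph ball and is a product of
  intervals, which matches tuples of windows.\<close>

definition int_cube :: "nat \<Rightarrow> (int ^ 'd::finite) set" where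
  "int_cube r = {v. \<forall>i. \<bar>v $ i\<bar> \<le> int r}"

lemma int_cube_mono: "s \<le> r \<Longrightarrow> int_cube s \<subseteq> int_cube r"
  unfolding int_cube_def by (intro Collect_mono impI) (meson of_nat_le_iff order_trans)

lemma grid_ball_subset_int_cube: "grid_ball 0 r \<subseteq> int_cube r"
proof
  fix v :: "int ^ 'd" assume "v \<in> grid_ball 0 r"
  then obtain k where k: "k \<le> r" "(0, v) \<in> grid_adj ^^ k"
    by (auto simp: grid_ball_def hops_def)
  have "\<bar>v $ i\<bar> \<le> int r" for i
    using relpow_grid_adj_bound[OF k(2), of i] k(1) by simp
  then show "v \<in> int_cube r" by (simp add: int_cube_def)
qed

lemma grid_ball_mono: "s \<le> r \<Longrightarrow> grid_ball v s \<subseteq> grid_ball v r"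
  by (auto simp: grid_ball_def hops_def intro: le_trans)

lemma center_in_grid_ball: "v \<in> grid_ball v r"
  by (auto simp: grid_ball_def hops_def intro!: exI[of _ 0])

lemma grid_ball_translate: "u \<in> grid_ball 0 r \<Longrightarrow> v + u \<in> grid_ball v r"
  unfolding grid_ball_def hops_def using relpow_grid_adj_translate[of 0 u _ v] by auto

lemma
  shows finite_int_cube: "finite (int_cube r :: (int ^ 'd::finite) set)"
    and card_int_cube: "card (int_cube r :: (int ^ 'd::finite) set) \<le> (2 * r + 1) ^ CARD('d)"
proof -
  let ?B = "UNIV \<rightarrow>\<^sub>E {- int r..int r} :: ('d \<Rightarrow> int) set"
  have inj: "inj_on vec_nth (int_cube r :: (int ^ 'd) set)"
    by (auto simp: inj_on_def vec_eq_iff)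
  have sub: "vec_nth ` (int_cube r :: (int ^ 'd) set) \<subseteq> ?B"
    by (auto simp: int_cube_def abs_le_iff) (smt (verit))+
  have fin: "finite ?B" by (intro finite_PiE) auto
  show "finite (int_cube r :: (int ^ 'd) set)"
    by (rule inj_on_finite[OF inj sub fin])
  have "card ?B = (2 * r + 1) ^ CARD('d)"
    by (simp add: card_PiE nat_add_distrib nat_mult_distrib)
  then show "card (int_cube r :: (int ^ 'd) set) \<le> (2 * r + 1) ^ CARD('d)"
    using card_inj_on_le[OF inj sub fin] by simp
qed

lemma finite_grid_ball: "finite (grid_ball (0 :: int ^ 'd::finite) r)"
  by (rule finite_subset[OF grid_ball_subset_int_cube finite_int_cube])

text \<open>Only finitely many views enter this form of the event, from which both its measurability
  and its locality are derived.\<close>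

lemma coding_radius_gr_iff:
  "enat r < coding_radius A l v \<longleftrightarrow> (\<forall>s\<le>r. grid_view l v s \<notin> stops A s)"
proof
  assume *: "enat r < coding_radius A l v"
  show "\<forall>s\<le>r. grid_view l v s \<notin> stops A s"
  proof (intro allI impI notI)
    fix s assume "s \<le> r" "grid_view l v s \<in> stops A s"
    then have "coding_radius A l v \<le> enat s"
      unfolding coding_radius_def by (intro INF_lower) simp
    also have "\<dots> \<le> enat r" using \<open>s \<le> r\<close> by simp
    finally show False using * by simp
  qed
next
  assume "\<forall>s\<le>r. grid_view l v s \<notin> stops A s"
  then have "enat (Suc r) \<le> coding_radius A l v"
    unfolding coding_radius_def by (intro INF_greatest) (auto simp: not_less_eq_eq)
  then show "enat r < coding_radius A l v"
    by (rule less_le_trans[rotated]) simp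
qed

text \<open>Equal views force both runs to stop at the same radius. Labellings and roots may differ,
  so that a run at a neighbour can be compared with a run at 0.\<close>

lemma ulocal_output_cong:
  assumes le: "coding_radius A l v \<le> enat T"
    and eq: "\<And>r. r \<le> T \<Longrightarrow> grid_view l v r = grid_view l' v' r"
  shows "ulocal_output A l v = ulocal_output A l' v'"
proof -
  obtain r where r: "coding_radius A l v = enat r" "r \<le> T"
    using le by (cases "coding_radius A l v") auto
  have "coding_radius A l' v' = enat r"
  proof (rule antisym)
    have "\<exists>s\<le>r. grid_view l v s \<in> stops A s"
      using coding_radius_gr_iff[of r A l v] r by auto
    then have "\<exists>s\<le>r. grid_view l' v' s \<in> stops A s"
      using eq r(2) by (metis le_trans)
    then show "coding_radius A l' v' \<le> enat r"
      using coding_radius_gr_iff[of r A l' v'] by (auto simp: not_less[symmetric])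
    show "enat r \<le> coding_radius A l' v'"
    proof (cases r)
      case (Suc q)
      then have "\<forall>s\<le>q. grid_view l v s \<notin> stops A s"
        using coding_radius_gr_iff[of q A l v] r by simp
      then have "\<forall>s\<le>q. grid_view l' v' s \<notin> stops A s"
        using eq r(2) Suc by (metis Suc_leD le_trans)
      then have "enat q < coding_radius A l' v'"
        by (simp add: coding_radius_gr_iff)
      then show ?thesis using Suc by (simp add: Suc_ile_eq)
    qed (simp add: zero_enat_def[symmetric])
  qed
  then show ?thesis
    using r eq[OF r(2)] by (simp add: ulocal_output_def)
qed

section \<open>Derandomization\<close>

lemma prob_space_unit_uniform: "prob_space unit_uniform"
  by (rule prob_spaceI) (simp add: unit_uniform_def emeasure_restrict_space space_restrict_space)

lemma prob_space_random_labels: "prob_space random_labels"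
  unfolding random_labels_def by (rule prob_space_PiM) (rule prob_space_unit_uniform)

lemma random_labels_reindex:
  fixes \<phi> :: "int ^ 'd::finite \<Rightarrow> int ^ 'd"
  assumes "inj \<phi>"
  shows "distr random_labels random_labels (\<lambda>\<omega> v. \<omega> (\<phi> v)) = random_labels"
  using distr_PiM_reindex[of UNIV "\<lambda>_. unit_uniform" \<phi> UNIV] assms prob_space_unit_uniform
  by (simp add: random_labels_def restrict_UNIV)

lemma measurable_random_labels_reindex:
  fixes \<phi> :: "int ^ 'd::finite \<Rightarrow> int ^ 'd"
  shows "(\<lambda>\<omega> v. \<omega> (\<phi> v)) \<in> random_labels \<rightarrow>\<^sub>M random_labels"
proof -
  have "(\<lambda>\<omega>. \<lambda>v\<in>UNIV. \<omega> (\<phi> v)) \<in> random_labels \<rightarrow>\<^sub>M random_labels"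
    unfolding random_labels_def by (intro measurable_restrict measurable_component_singleton) auto
  then show ?thesis by (simp add: restrict_UNIV)
qed

lemma measurable_grid_view:
  fixes L :: "('a, 'b, 'd::finite) lcl"
  assumes x: "x \<in> UNIV \<rightarrow> inputs L"
  shows "(\<lambda>\<omega>. grid_view (\<lambda>w. (x w, \<omega> w)) v r) \<in> random_labels \<rightarrow>\<^sub>M nbhd_space L r"
  unfolding grid_view_def nbhd_space_def random_labels_def
proof (intro measurable_restrict measurable_Pair)
  fix u :: "int ^ 'd"
  show "(\<lambda>_. x (v + u)) \<in> (\<Pi>\<^sub>M v\<in>UNIV. unit_uniform) \<rightarrow>\<^sub>M count_space (inputs L)"
    using funcset_mem[OF x, of "v + u"] by (intro measurable_const) simp
  show "(\<lambda>\<omega>. \<omega> (v + u)) \<in> (\<Pi>\<^sub>M v\<in>UNIV. unit_uniform) \<rightarrow>\<^sub>M unit_uniform"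
    by (rule measurable_component_singleton) simp
qed

lemma sets_coding_radius_gr:
  fixes L :: "('a, 'b, 'd::finite) lcl"
  assumes A: "is_ulocal_alg L A" and x: "x \<in> UNIV \<rightarrow> inputs L"
  shows "{\<omega> \<in> space random_labels. enat r < coding_radius A (\<lambda>w. (x w, \<omega> w)) v}
    \<in> sets random_labels"
proof -
  define V where "V s = (\<lambda>\<omega>. grid_view (\<lambda>w. (x w, \<omega> w)) v s) -` stops A s \<inter> space random_labels" for s
  have "V s \<in> sets random_labels" for s
    unfolding V_def
    by (rule measurable_sets[OF measurable_grid_view[OF x]]) (use A in \<open>simp add: is_ulocal_alg_def\<close>)
  then have "space random_labels - (\<Union>s\<in>{..r}. V s) \<in> sets random_labels"
    by (intro sets.Diff sets.top sets.finite_UN) simp_all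
  also have "space random_labels - (\<Union>s\<in>{..r}. V s)
      = {\<omega> \<in> space random_labels. enat r < coding_radius A (\<lambda>w. (x w, \<omega> w)) v}"
    unfolding coding_radius_gr_iff V_def by blast
  finally show ?thesis .
qed

text \<open>A run that looks up to radius \<open>r\<close> never sees \<open>x\<close> outside the
  ball, so \<open>x\<close> may be replaced by its restriction, and the supremum is taken over such
  restrictions.\<close>

lemma measure_coding_radius_gr_le:
  fixes L :: "('a, 'b, 'd::finite) lcl"
  assumes "x \<in> UNIV \<rightarrow> inputs L"
  shows "measure random_labels {\<omega> \<in> space random_labels. enat r < coding_radius A (\<lambda>w. (x w, \<omega> w)) v}
    \<le> prob_radius_greater L A v r"
proof -
  interpret prob_space random_labels by (rule prob_space_random_labels)
  let ?E = "\<lambda>x. {\<omega> \<in> space random_labels. enat r < coding_radius A (\<lambda>w. (x w, \<omega> w)) v}"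
  let ?x = "restrict x (grid_ball v r)"
  have eq: "grid_view (\<lambda>w. (x w, \<omega> w)) v s = grid_view (\<lambda>w. (?x w, \<omega> w)) v s" if "s \<le> r" for \<omega> s
    unfolding grid_view_def
  proof (rule restrict_ext)
    fix u :: "int ^ 'd" assume "u \<in> grid_ball 0 s"
    then have "v + u \<in> grid_ball v r"
      using grid_ball_mono[OF that] by (blast intro: grid_ball_translate)
    then show "(x (v + u), \<omega> (v + u)) = (?x (v + u), \<omega> (v + u))" by simp
  qed
  have "(enat r < coding_radius A (\<lambda>w. (x w, \<omega> w)) v) = (enat r < coding_radius A (\<lambda>w. (?x w, \<omega> w)) v)" for \<omega>
    unfolding coding_radius_gr_iff by (intro all_cong) (simp only: eq)
  then have "?E x = ?E ?x" by simp
  moreover have "measure random_labels (?E ?x) \<le> prob_radius_greater L A v r"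
    unfolding prob_radius_greater_def
  proof (rule cSUP_upper[where f = "\<lambda>x. measure random_labels (?E x)" and x = ?x])
    show "?x \<in> grid_ball v r \<rightarrow>\<^sub>E inputs L" using assms by auto
    show "bdd_above ((\<lambda>x. measure random_labels (?E x)) ` (grid_ball v r \<rightarrow>\<^sub>E inputs L))"
      by (rule bdd_aboveI2[of _ _ 1]) (rule prob_le_1)
  qed
  ultimately show ?thesis by simp
qed

text \<open>If every outcome satisfying \<open>P\<close> lay in some \<open>E j\<close>, the union
  of these events would have probability 1, more than the sum of the bounds.\<close>

lemma (in prob_space) union_bound_exists:
  assumes "finite J" "\<And>j. j \<in> J \<Longrightarrow> E j \<in> events" "\<And>j. j \<in> J \<Longrightarrow> prob (E j) \<le> e"
    and "real (card J) * e < 1" "AE \<omega> in M. P \<omega>"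
  shows "\<exists>\<omega>\<in>space M. P \<omega> \<and> (\<forall>j\<in>J. \<omega> \<notin> E j)"
proof (rule ccontr)
  assume neg: "\<not> ?thesis"
  have "AE \<omega> in M. \<omega> \<in> (\<Union>j\<in>J. E j)"
    using assms(5) AE_space by eventually_elim (use neg in blast)
  then have "prob (\<Union>j\<in>J. E j) = 1"
    using assms(1,2) by (subst prob_eq_1) auto
  moreover have "prob (\<Union>j\<in>J. E j) \<le> (\<Sum>j\<in>J. prob (E j))"
    using assms(1,2) by (intro finite_measure_subadditive_finite) auto
  moreover have "\<dots> \<le> real (card J) * e"
    using assms(3) by (intro sum_bounded_above) auto
  ultimately show False using assms(4) by simp
qed

text \<open>Re-indexing the random labels along an injection does not change their distribution, so
  the union bound yields one labelling that serves finitely many identifier assignments at once.\<close>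

lemma derandomize:
  fixes L :: "('a, 'b, 'd::finite) lcl" and \<Phi> :: "(int ^ 'd \<Rightarrow> int ^ 'd) set"
  assumes A: "is_ulocal_alg L A" "ulocal_solves L A"
    and e: "\<And>v. prob_radius_greater L A v T \<le> e"
    and fin: "finite \<Phi>" "finite X" "finite U"
    and \<Phi>: "\<And>\<phi>. \<phi> \<in> \<Phi> \<Longrightarrow> inj \<phi>" and X: "X \<subseteq> UNIV \<rightarrow> inputs L"
    and less: "real (card \<Phi> * card X * card U) * e < 1"
  shows "\<exists>\<omega>. \<forall>\<phi>\<in>\<Phi>. \<forall>x\<in>X.
    grid_coloring L x (ulocal_output A (\<lambda>w. (x w, \<omega> (\<phi> w)))) \<and>
    (\<forall>u\<in>U. coding_radius A (\<lambda>w. (x w, \<omega> (\<phi> w))) u \<le> enat T)"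
proof -
  interpret prob_space "random_labels :: (int ^ 'd \<Rightarrow> real) measure"
    by (rule prob_space_random_labels)
  let ?M = "random_labels :: (int ^ 'd \<Rightarrow> real) measure"
  define G where "G x u = {\<omega> \<in> space ?M. enat T < coding_radius A (\<lambda>w. (x w, \<omega> w)) u}" for x u
  \<comment> \<open>\<open>E (\<phi>, x, u)\<close> is the event that the run at \<open>u\<close>
    with inputs \<open>x\<close> and reindexed labels \<open>\<omega> (\<phi> v)\<close> looks
    beyond \<open>T\<close>.\<close>
  define E where "E = (\<lambda>(\<phi>, x, u). (\<lambda>\<omega> v. \<omega> (\<phi> v)) -` G x u \<inter> space ?M)"
  define P where "P \<omega> \<longleftrightarrow> (\<forall>(\<phi>, x)\<in>\<Phi> \<times> X.
    grid_coloring L x (ulocal_output A (\<lambda>w. (x w, \<omega> (\<phi> w)))))" for \<omega>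
  have xin: "x \<in> UNIV \<rightarrow> inputs L" if "x \<in> X" for x using X that by blast
  have G: "G x u \<in> events" if "x \<in> X" for x u
    unfolding G_def by (rule sets_coding_radius_gr[OF A(1) xin[OF that]])
  have "\<exists>\<omega>\<in>space ?M. P \<omega> \<and> (\<forall>j\<in>\<Phi> \<times> X \<times> U. \<omega> \<notin> E j)"
  proof (rule union_bound_exists)
    show "finite (\<Phi> \<times> X \<times> U)" using fin by simp
    show "real (card (\<Phi> \<times> X \<times> U)) * e < 1"
      using less by (simp add: card_cartesian_product mult.assoc)
  next
    fix j assume "j \<in> \<Phi> \<times> X \<times> U"
    then obtain \<phi> x u where j: "j = (\<phi>, x, u)" and mem: "\<phi> \<in> \<Phi>" "x \<in> X" by auto
    show "E j \<in> events"
      using measurable_sets[OF measurable_random_labels_reindex G[OF mem(2)]] by (simp add: E_def j)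
    have "prob (E j) = measure (distr ?M ?M (\<lambda>\<omega> v. \<omega> (\<phi> v))) (G x u)"
      unfolding E_def j prod.case
      by (rule measure_distr[symmetric, OF measurable_random_labels_reindex G[OF mem(2)]])
    also have "\<dots> = prob (G x u)"
      by (simp only: random_labels_reindex[OF \<Phi>[OF mem(1)]])
    also have "\<dots> \<le> e"
      unfolding G_def using measure_coding_radius_gr_le[OF xin[OF mem(2)]] e by (rule order_trans)
    finally show "prob (E j) \<le> e" .
  next
    \<comment> \<open>Almost sure correctness, given for each fixed input labelling, is pulled back
      along the reindexing map; finitely many pairs can then be combined.\<close>
    have "AE \<omega> in ?M. grid_coloring L x (ulocal_output A (\<lambda>w. (x w, \<omega> (\<phi> w))))"
      if "\<phi> \<in> \<Phi>" "x \<in> X" for \<phi> x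
    proof -
      have "AE \<omega> in ?M. grid_coloring L x (ulocal_output A (\<lambda>w. (x w, \<omega> w)))"
        using A(2) xin[OF that(2)] unfolding ulocal_solves_def by (fastforce elim: eventually_mono)
      then have "AE \<omega> in distr ?M ?M (\<lambda>\<omega> v. \<omega> (\<phi> v)).
          grid_coloring L x (ulocal_output A (\<lambda>w. (x w, \<omega> w)))"
        by (simp only: random_labels_reindex[OF \<Phi>[OF that(1)]])
      then show ?thesis
        by (rule AE_distrD[OF measurable_random_labels_reindex])
    qed
    then show "AE \<omega> in ?M. P \<omega>"
      unfolding P_def using fin by (intro AE_finite_allI) auto
  qed
  then obtain \<omega> where \<omega>: "\<omega> \<in> space ?M" "P \<omega>" "\<And>j. j \<in> \<Phi> \<times> X \<times> U \<Longrightarrow> \<omega> \<notin> E j" by blast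
  have "coding_radius A (\<lambda>w. (x w, \<omega> (\<phi> w))) u \<le> enat T"
    if "\<phi> \<in> \<Phi>" "x \<in> X" "u \<in> U" for \<phi> x u
  proof -
    have "(\<lambda>v. \<omega> (\<phi> v)) \<in> space ?M"
      by (rule measurable_space[OF measurable_random_labels_reindex \<omega>(1)])
    then show ?thesis
      using \<omega>(1) \<omega>(3)[of "(\<phi>, x, u)"] that by (auto simp: E_def G_def not_less)
  qed
  then show ?thesis using \<omega>(2) unfolding P_def by blast
qed

section \<open>Eliminating the identifiers\<close>

text \<open>Only positions inside the list matter; the values outside keep the map injective on all of
  the integers.\<close>

definition place :: "nat \<Rightarrow> nat list \<Rightarrow> int \<Rightarrow> int" where
  "place N xs m =
     (if m < 0 then m else if m < int (length xs) then int (xs ! nat m) else m + int N)"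

text \<open>On the three pieces the values are negative, in \<open>{0..<N}\<close>, or at least
  \<open>N\<close>; the middle piece is injective because an increasing list is distinct.\<close>

lemma inj_place:
  assumes "xs \<in> inc_lists N q"
  shows "inj (place N xs)"
proof -
  have dist: "distinct xs" and lt: "\<And>x. x \<in> set xs \<Longrightarrow> x < N"
    using assms by (auto simp: inc_lists_def strict_sorted_iff)
  have lt': "xs ! nat m < N" if "0 \<le> m" "m < int (length xs)" for m
    using lt[OF nth_mem] that by (simp add: nat_less_iff)
  have nth_eq: "m = m'" if "0 \<le> m" "m < int (length xs)" "0 \<le> m'" "m' < int (length xs)"
    "xs ! nat m = xs ! nat m'" for m m'
    using nth_eq_iff_index_eq[OF dist, of "nat m" "nat m'"] that by (simp add: nat_less_iff)
  show ?thesis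
  proof (rule injI)
    fix m m' assume eq: "place N xs m = place N xs m'"
    show "m = m'"
      using eq lt'[of m] lt'[of m'] nth_eq[of m m']
      unfolding place_def by (auto split: if_splits)
  qed
qed

text \<open>A vertex gets a tuple as identifier, with one list per coordinate. Adding
  \<open>r\<close> moves the cube of radius \<open>r\<close> to the indices \<open>0\<close> to
  \<open>2 * r\<close>, covered exactly by lists of length \<open>2 * r + 1\<close>.\<close>

definition place_grid :: "nat \<Rightarrow> ('d \<Rightarrow> nat list) \<Rightarrow> nat \<Rightarrow> int ^ 'd \<Rightarrow> int ^ 'd" where
  "place_grid N l r v = (\<chi> i. place N (l i) (v $ i + int r))"

lemma inj_place_grid:
  assumes "l \<in> UNIV \<rightarrow> inc_lists N q"
  shows "inj (place_grid N l r)"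
proof (rule injI)
  fix v w assume eq: "place_grid N l r v = place_grid N l r w"
  have "v $ i = w $ i" for i
  proof -
    have "place N (l i) (v $ i + int r) = place N (l i) (w $ i + int r)"
      using eq by (simp add: place_grid_def vec_eq_iff)
    then show ?thesis
      using injD[OF inj_place[of "l i" N q]] assms by (metis Pi_iff UNIV_I add_right_cancel)
  qed
  then show "v = w" by (simp add: vec_eq_iff)
qed

lemma place_window:
  assumes "length xs = 2 * T + 1 + k" "s \<le> k" "\<bar>z\<bar> \<le> int T"
  shows "place N (window (Suc (2 * T)) s xs) (z + int T) = place N xs (z + int T + int s)"
proof -
  have "nat (z + int T + int s) = s + nat (z + int T)" using assms by simp
  then show ?thesis
    using assms by (auto simp: place_def window_def nth_take nat_less_iff)
qed

text \<open>Moving the root only shifts windows: around \<open>u\<close> the long lists show the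
  identifiers that their windows at offsets \<open>u $ i + t\<close> show around 0.\<close>

lemma place_grid_window:
  fixes u z :: "int ^ 'd::finite"
  assumes l: "l \<in> UNIV \<rightarrow> inc_lists N (Suc (2 * T) + 2 * t)"
    and u: "u \<in> int_cube t" and z: "z \<in> int_cube T"
  shows "place_grid N (\<lambda>i. window (Suc (2 * T)) (nat (u $ i + int t)) (l i)) T z =
    place_grid N l (T + t) (u + z)"
proof -
  have "place N (window (Suc (2 * T)) (nat (u $ i + int t)) (l i)) (z $ i + int T) =
    place N (l i) (u $ i + z $ i + int (T + t))" for i
  proof -
    have "l i \<in> inc_lists N (Suc (2 * T) + 2 * t)" using l by auto
    then have len: "length (l i) = 2 * T + 1 + 2 * t" by (simp add: inc_lists_def)
    have b: "\<bar>u $ i\<bar> \<le> int t" "\<bar>z $ i\<bar> \<le> int T" using u z by (auto simp: int_cube_def)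
    then have "nat (u $ i + int t) \<le> 2 * t" by simp
    moreover have "int (nat (u $ i + int t)) = u $ i + int t" using b(1) by simp
    ultimately show ?thesis
      using place_window[OF len _ b(2), of "nat (u $ i + int t)" N]
      by (simp add: algebra_simps)
  qed
  then show ?thesis by (simp add: place_grid_def)
qed

lemma inputs_nonempty: "inputs L \<noteq> {}"
  by (auto simp: inputs_def)

lemma finite_inputs: "is_lcl L \<Longrightarrow> finite (inputs L)"
  by (simp add: is_lcl_def inputs_def)

lemma grid_coloring_out_labels:
  assumes "is_lcl L" "grid_coloring L x y"
  shows "y v \<in> out_labels L"
proof -
  have "grid_view (\<lambda>w. (x w, y w)) v (radius L) \<in> grid_ball 0 (radius L) \<rightarrow>\<^sub>E inputs L \<times> out_labels L"
    using assms unfolding is_lcl_def grid_coloring_def by blast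
  from PiE_mem[OF this center_in_grid_ball] show ?thesis
    by (simp add: grid_view_def center_in_grid_ball)
qed

text \<open>Once the randomness and an identifier pattern are fixed, the colour of a tuple of windows is
  the whole map from inputs to outputs that the algorithm induces on them. On a family of lists
  all of whose windows have the same colour, this map no longer depends on identifiers.\<close>

lemma exists_identifier_free_rule:
  fixes L :: "('a, 'b, 'd::finite) lcl"
  assumes lcl: "is_lcl L" and A: "is_ulocal_alg L A" "ulocal_solves L A"
    and e: "\<And>v. prob_radius_greater L A v T \<le> e" "0 < e"
    and less: "real (twr ((2 + 2 * CARD('d)) * T + (2 * radius L + CARD('d) + card (inputs L) +
      card (out_labels L) + 19 + CARD('d) * (2 * radius L + 10)))) < 1 / e"
  shows "\<exists>F. \<forall>x\<in>UNIV \<rightarrow> inputs L. grid_coloring L x (\<lambda>v. F (grid_view x v T))"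
proof -
  define t where "t = radius L"
  define D where "D = CARD('d)"
  define a where "a = card (inputs L)"
  \<comment> \<open>\<open>undefined\<close> stands in where a run on arbitrary windows returns no
    valid output label, which keeps the colours in a finite set.\<close>
  define C where "C = insert undefined (out_labels L)"
  define b where "b = Suc (card (out_labels L))"
  define r where "r = T + t"
  \<comment> \<open>\<open>n\<close> dominates the widths, the dimension and the label counts, and
    \<open>twr (n + 9)\<close> bounds the number of colours of window tuples. \<open>m\<close> and
    \<open>N\<close> are then dictated by \<open>shift_graph_grid\<close> with
    \<open>p = 2 * T\<close> and \<open>k = 2 * t\<close>.\<close>
  define n where "n = 2 * T + 2 * t + D + a + b + 1"
  define m where "m = n + 9 + D * (2 * T + 2 * t + 10)"
  define N where "N = Suc (twr m)"
  define Q where "Q = Suc (2 * T) + 2 * t"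
  have finI: "finite (inputs L)" using lcl by (rule finite_inputs)
  have finC: "finite C" and cardC: "card C \<le> b"
    using lcl by (auto simp: C_def b_def is_lcl_def card_insert_if)
  have le_twr_n: "c \<le> twr (n + j)" if "c \<le> n" for c j
    using that le_twr[of "n + j"] by simp
  obtain i0 where i0: "i0 \<in> inputs L" using inputs_nonempty by blast
  have int_cube_le: "card (int_cube s :: (int ^ 'd) set) \<le> twr (n + 3)" if "2 * s + 1 \<le> n" for s
  proof -
    have "card (int_cube s :: (int ^ 'd) set) \<le> (2 * s + 1) ^ D" unfolding D_def by (rule card_int_cube)
    also have "\<dots> \<le> twr (n + 3)"
      using le_twr_n[OF that, of 0] le_twr_n[of D 0] by (intro power_le_twr) (auto simp: n_def)
    finally show ?thesis .
  qed
  have in_le: "card (B \<rightarrow>\<^sub>E inputs L) \<le> twr (n + 6)"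
    if "finite B" "card B \<le> twr (n + 3)" for B :: "(int ^ 'd) set"
  proof -
    have "card (B \<rightarrow>\<^sub>E inputs L) = a ^ card B" using that(1) by (simp add: card_PiE a_def)
    also have "\<dots> \<le> twr (n + 3 + 3)"
      using le_twr_n[of a 3] that(2) by (intro power_le_twr) (auto simp: n_def)
    finally show ?thesis by (simp add: add.commute)
  qed

  define \<Phi> where "\<Phi> = (\<lambda>l :: 'd \<Rightarrow> nat list. place_grid N l r) ` (UNIV \<rightarrow>\<^sub>E inc_lists N Q)"
  \<comment> \<open>Runs of radius \<open>T\<close> rooted in the cube of radius \<open>t\<close>
    read inputs only in the cube of radius \<open>r\<close>; filling the rest with \<open>i0\<close>
    leaves finitely many labellings for the union bound.\<close>
  define ext where "ext x = (\<lambda>v :: int ^ 'd. if v \<in> int_cube r then x v else i0)" for x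
  define X where "X = ext ` (int_cube r \<rightarrow>\<^sub>E inputs L)"
  have fin: "finite \<Phi>" "finite X" "finite (int_cube t :: (int ^ 'd) set)"
    unfolding \<Phi>_def X_def using finI
    by (intro finite_imageI finite_PiE finite_int_cube finite_inc_lists finite; simp)+
  have "card \<Phi> \<le> card ((UNIV :: 'd set) \<rightarrow>\<^sub>E inc_lists N Q)"
    unfolding \<Phi>_def by (intro card_image_le finite_PiE finite finite_inc_lists)
  also have "\<dots> = card (inc_lists N Q) ^ D" by (simp add: card_PiE D_def)
  also have "\<dots> \<le> (N ^ Q) ^ D" by (intro power_mono card_inc_lists) simp
  also have "\<dots> = N ^ (Q * D)" by (simp only: power_mult)
  also have "\<dots> \<le> twr (m + 1 + 3)"
  proof (rule power_le_twr)
    show "N \<le> twr (m + 1)"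
      using less_exp[of "twr m"] by (simp add: N_def Suc_le_eq twr.simps)
    have "Q * D \<le> twr (n + 2)"
      using le_twr_n[of Q 0] le_twr_n[of D 0]
      by (intro mult_le_twr) (auto simp: n_def Q_def b_def)
    also have "\<dots> \<le> twr (m + 1)" by (rule twr_mono) (simp add: m_def)
    finally show "Q * D \<le> twr (m + 1)" .
  qed
  finally have card\<Phi>: "card \<Phi> \<le> twr (m + 4)" by (simp add: add.commute)
  have "card X \<le> card ((int_cube r :: (int ^ 'd) set) \<rightarrow>\<^sub>E inputs L)"
    unfolding X_def using finI by (intro card_image_le finite_PiE finite_int_cube)
  also have "\<dots> \<le> twr (n + 6)"
    by (intro in_le finite_int_cube int_cube_le) (simp add: r_def n_def b_def)
  also have "\<dots> \<le> twr (m + 4)" by (rule twr_mono) (simp add: m_def)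
  finally have "card \<Phi> * card X \<le> twr (m + 4 + 2)" using card\<Phi> by (intro mult_le_twr)
  then have "card \<Phi> * card X \<le> twr (m + 6)" by (simp add: add.commute)
  moreover have "card (int_cube t :: (int ^ 'd) set) \<le> twr (m + 6)"
    using int_cube_le[of t] twr_mono[of "n + 3" "m + 6"] by (auto simp: n_def b_def m_def)
  ultimately have "card \<Phi> * card X * card (int_cube t :: (int ^ 'd) set) \<le> twr (m + 6 + 2)"
    by (rule mult_le_twr)
  \<comment> \<open>This expansion is the tower height in the hypothesis: one \<open>2 * T\<close>
    comes from \<open>n\<close>, and one more per coordinate from \<open>m\<close>.\<close>
  moreover have "m + 6 + 2 = (2 + 2 * D) * T + (2 * t + D + a + card (out_labels L) + 19 + D * (2 * t + 10))"
    by (simp add: m_def n_def b_def algebra_simps)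
  ultimately have "real (card \<Phi> * card X * card (int_cube t :: (int ^ 'd) set)) < 1 / e"
    using less unfolding D_def[symmetric] t_def[symmetric] a_def[symmetric]
    by (metis of_nat_le_iff order_le_less_trans)
  then have "real (card \<Phi> * card X * card (int_cube t :: (int ^ 'd) set)) * e < 1"
    using e(2) by (simp only: pos_less_divide_eq)
  moreover have "inj \<phi>" if "\<phi> \<in> \<Phi>" for \<phi>
    using that unfolding \<Phi>_def by (auto intro!: inj_place_grid[where q = Q])
  moreover have "X \<subseteq> UNIV \<rightarrow> inputs L"
    using i0 by (auto simp: X_def ext_def)
  ultimately obtain \<omega> :: "int ^ 'd \<Rightarrow> real" where \<omega>: "\<And>\<phi> x. \<phi> \<in> \<Phi> \<Longrightarrow> x \<in> X \<Longrightarrow>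
      grid_coloring L x (ulocal_output A (\<lambda>w. (x w, \<omega> (\<phi> w)))) \<and>
      (\<forall>u\<in>int_cube t. coding_radius A (\<lambda>w. (x w, \<omega> (\<phi> w))) u \<le> enat T)"
    using derandomize[OF A e(1) fin] by blast

  define out where "out w y = ulocal_output A (\<lambda>z. (y z, \<omega> (place_grid N w T z))) 0" for w y
  define \<kappa> where "\<kappa> w = (\<lambda>y\<in>grid_ball 0 T \<rightarrow>\<^sub>E inputs L.
    if out w y \<in> out_labels L then out w y else undefined)" for w
  let ?Y = "grid_ball (0 :: int ^ 'd) T \<rightarrow>\<^sub>E inputs L"
  have finY: "finite ?Y" using finI by (intro finite_PiE finite_grid_ball)
  have "card (grid_ball (0 :: int ^ 'd) T) \<le> card (int_cube T :: (int ^ 'd) set)"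
    by (intro card_mono finite_int_cube grid_ball_subset_int_cube)
  also have "\<dots> \<le> twr (n + 3)" by (rule int_cube_le) (simp add: n_def b_def)
  finally have "card ?Y \<le> twr (n + 6)" by (intro in_le finite_grid_ball)
  moreover have "card C \<le> twr (n + 6)"
    using cardC le_twr_n[of b 6] by (simp add: n_def)
  ultimately have "card C ^ card ?Y \<le> twr (n + 6 + 3)" by (intro power_le_twr)
  then have "card (?Y \<rightarrow>\<^sub>E C) \<le> twr (n + 9)"
    using finY by (simp add: card_PiE add.commute)
  moreover have "\<kappa> \<in> (UNIV \<rightarrow>\<^sub>E inc_lists N (Suc (2 * T))) \<rightarrow> (?Y \<rightarrow>\<^sub>E C)"
    by (auto simp: \<kappa>_def C_def)
  moreover have "finite (?Y \<rightarrow>\<^sub>E C)" by (intro finite_PiE finY finC)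
  moreover have "Suc (2 * t) \<le> twr (n + 9)" "Suc (2 * T) \<le> twr (n + 9)"
    "card (UNIV :: 'd set) \<le> twr (n + 9)"
    by (rule le_twr_n; simp add: n_def b_def D_def)+
  moreover have "twr (n + 9 + card (UNIV :: 'd set) * (2 * T + 2 * t + 10)) < N"
    by (simp add: N_def m_def D_def)
  \<comment> \<open>Neighbours at coordinate offsets \<open>-t\<close> to \<open>t\<close>
    correspond to window offsets \<open>0\<close> to \<open>2 * t\<close>; on \<open>l\<close> all
    of them share one colour, the rule \<open>F\<close>.\<close>
  ultimately have "\<exists>l\<in>UNIV \<rightarrow>\<^sub>E inc_lists N (Suc (2 * T) + 2 * t). \<exists>c. \<forall>s\<in>UNIV \<rightarrow> {..2 * t}.
      \<kappa> (\<lambda>i\<in>UNIV. window (Suc (2 * T)) (s i) (l i)) = c"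
    by (intro shift_graph_grid[OF finite])
  then obtain l F where l: "l \<in> UNIV \<rightarrow>\<^sub>E inc_lists N Q"
    and F: "\<And>s. s \<in> UNIV \<rightarrow> {..2 * t} \<Longrightarrow> \<kappa> (\<lambda>i. window (Suc (2 * T)) (s i) (l i)) = F"
    unfolding restrict_UNIV Q_def by blast
  have l\<Phi>: "place_grid N l r \<in> \<Phi>" unfolding \<Phi>_def using l by (rule imageI)
  show ?thesis
  proof (intro exI ballI)
    fix x :: "int ^ 'd \<Rightarrow> 'a option" assume x: "x \<in> UNIV \<rightarrow> inputs L"
    show "grid_coloring L x (\<lambda>v. F (grid_view x v T))"
      unfolding grid_coloring_def
    proof
      fix v :: "int ^ 'd"
      \<comment> \<open>Translating by \<open>v\<close> and truncating brings the claim at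
        \<open>v\<close> to the cube around 0, where \<open>x'\<close> is among the labellings
        served by \<open>\<omega>\<close>.\<close>
      define x' where "x' = ext (\<lambda>z\<in>int_cube r. x (v + z))"
      have x'X: "x' \<in> X" unfolding X_def x'_def using x by (intro imageI) auto
      have x': "x' z = x (v + z)" if "z \<in> int_cube r" for z
        using that by (simp add: x'_def ext_def)
      define O' where "O' = ulocal_output A (\<lambda>w. (x' w, \<omega> (place_grid N l r w)))"
      have good: "grid_coloring L x' O'"
        "\<And>u. u \<in> int_cube t \<Longrightarrow> coding_radius A (\<lambda>w. (x' w, \<omega> (place_grid N l r w))) u \<le> enat T"
        using \<omega>[OF l\<Phi> x'X] by (auto simp: O'_def)
      \<comment> \<open>The run at \<open>u\<close> under the long lists has the output of a run at
        0 under the windows \<open>w\<close>, and the colour of \<open>w\<close> is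
        \<open>F\<close>.\<close>
      have out: "O' u = F (grid_view x (v + u) T)" if u: "u \<in> grid_ball 0 t" for u
      proof -
        have ub: "u \<in> int_cube t" using u grid_ball_subset_int_cube by blast
        have uz: "u + z \<in> int_cube r" if "z \<in> int_cube T" for z
        proof -
          have "\<bar>u $ i + z $ i\<bar> \<le> int r" for i
          proof -
            have "\<bar>u $ i\<bar> \<le> int t" "\<bar>z $ i\<bar> \<le> int T" using ub that by (auto simp: int_cube_def)
            then show ?thesis by (simp add: r_def)
          qed
          then show ?thesis by (simp add: int_cube_def)
        qed
        define s where "s i = nat (u $ i + int t)" for i
        define w where "w i = window (Suc (2 * T)) (s i) (l i)" for i
        have s: "s \<in> UNIV \<rightarrow> {..2 * t}"
        proof
          fix i
          have "\<bar>u $ i\<bar> \<le> int t" using ub by (simp add: int_cube_def)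
          then show "s i \<in> {..2 * t}" by (simp add: s_def)
        qed
        have "O' u = out w (grid_view x (v + u) T)"
          unfolding O'_def out_def
        proof (rule ulocal_output_cong[OF good(2)[OF ub]])
          fix q assume q: "q \<le> T"
          show "grid_view (\<lambda>w. (x' w, \<omega> (place_grid N l r w))) u q =
            grid_view (\<lambda>z. (grid_view x (v + u) T z, \<omega> (place_grid N w T z))) 0 q"
            unfolding grid_view_def[of "\<lambda>w. (x' w, _ w)"] grid_view_def[of "\<lambda>w. (grid_view _ _ _ w, _ w)"]
          proof (rule restrict_ext)
            fix z :: "int ^ 'd" assume "z \<in> grid_ball 0 q"
            then have zT: "z \<in> grid_ball 0 T" using grid_ball_mono[OF q] by blast
            then have zb: "z \<in> int_cube T" using grid_ball_subset_int_cube by blast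
            have "place_grid N w T z = place_grid N l r (u + z)"
              unfolding w_def s_def r_def
              by (rule place_grid_window[OF _ ub zb]) (use l in \<open>auto simp: Q_def\<close>)
            moreover have "x' (u + z) = grid_view x (v + u) T z"
              using zT by (simp add: x'[OF uz[OF zb]] grid_view_def add.assoc)
            ultimately show "(x' (u + z), \<omega> (place_grid N l r (u + z))) =
              (grid_view x (v + u) T (0 + z), \<omega> (place_grid N w T (0 + z)))" by simp
          qed
        qed
        \<comment> \<open>Validity of the colouring rules out the default branch in
          \<open>\<kappa>\<close>.\<close>
        moreover have "O' u \<in> out_labels L"
          by (rule grid_coloring_out_labels[OF lcl good(1)])
        moreover have "grid_view x (v + u) T \<in> ?Y"
          using x by (auto simp: grid_view_def)
        ultimately have "O' u = \<kappa> w (grid_view x (v + u) T)"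
          by (simp add: \<kappa>_def)
        moreover have "\<kappa> w = F" unfolding w_def by (rule F[OF s])
        ultimately show ?thesis by simp
      qed
      have "grid_view (\<lambda>w. (x w, F (grid_view x w T))) v (radius L) =
        grid_view (\<lambda>w. (x' w, O' w)) 0 (radius L)"
        unfolding grid_view_def[of "\<lambda>w. (x w, _ w)"] grid_view_def[of "\<lambda>w. (x' w, _ w)"]
      proof (rule restrict_ext)
        fix u :: "int ^ 'd" assume "u \<in> grid_ball 0 (radius L)"
        then have u: "u \<in> grid_ball 0 t" by (simp add: t_def)
        then have "u \<in> int_cube t" using grid_ball_subset_int_cube by blast
        then have "u \<in> int_cube r" using int_cube_mono[of t r] by (auto simp: r_def)
        then show "(x (v + u), F (grid_view x (v + u) T)) = (x' (0 + u), O' (0 + u))"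
          using x' out[OF u] by simp
      qed
      then show "grid_view (\<lambda>w. (x w, F (grid_view x w T))) v (radius L) \<in> patterns L"
        using good(1) by (simp add: grid_coloring_def)
    qed
  qed
qed

section \<open>From a rule without identifiers to constant complexity and triviality\<close>

text \<open>A labelling of the torus lifts to a periodic labelling of the grid.\<close>

lemma identifier_free_rule_imp_LOCAL:
  fixes L :: "('a, 'b, 'd::finite) lcl"
  assumes lcl: "is_lcl L"
    and F: "\<And>x. x \<in> UNIV \<rightarrow> inputs L \<Longrightarrow> grid_coloring L x (\<lambda>v. F (grid_view x v T))"
  shows "L \<in> LOCAL (\<lambda>_. T)"
proof -
  define A :: "('a, 'b, 'd) local_alg" where "A n y = F (\<lambda>u\<in>grid_ball 0 T. snd (y u))" for n y
  have "is_local_alg L (\<lambda>_. T) A"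
    unfolding is_local_alg_def
  proof (intro allI funcsetI)
    fix n and y :: "int ^ 'd \<Rightarrow> nat \<times> 'a option"
    assume y: "y \<in> grid_ball 0 T \<rightarrow>\<^sub>E UNIV \<times> inputs L"
    obtain i0 where i0: "i0 \<in> inputs L" using inputs_nonempty by blast
    \<comment> \<open>Any view extends to an input labelling of the grid; the colouring there
      certifies that the value of \<open>F\<close> is an output label.\<close>
    define x where "x u = (if u \<in> grid_ball 0 T then snd (y u) else i0)" for u
    have "snd (y u) \<in> inputs L" if "u \<in> grid_ball 0 T" for u
      using PiE_mem[OF y that] by auto
    then have "x \<in> UNIV \<rightarrow> inputs L" using i0 by (simp add: x_def)
    from grid_coloring_out_labels[OF lcl F[OF this]]
    have "F (grid_view x 0 T) \<in> out_labels L" .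
    also have "grid_view x 0 T = (\<lambda>u\<in>grid_ball 0 T. snd (y u))"
      unfolding grid_view_def by (rule restrict_ext) (simp add: x_def)
    finally show "A n y \<in> out_labels L" by (simp only: A_def)
  qed
  moreover have "local_solves L (\<lambda>_. T) A"
    unfolding local_solves_def torus_coloring_def
  proof (intro allI impI ballI)
    fix c :: real and k n :: nat and s :: "nat ^ 'd" and ident :: "int ^ 'd \<Rightarrow> nat"
      and x :: "int ^ 'd \<Rightarrow> 'a option" and v :: "int ^ 'd"
    assume n: "n = (\<Prod>i\<in>UNIV. s $ i)" "1 \<le> n" and x: "x \<in> torus s \<rightarrow> inputs L"
    have pos: "0 < s $ i" for i
    proof -
      have "(\<Prod>i\<in>UNIV. s $ i) \<noteq> 0" using n by linarith
      then show ?thesis by (simp add: prod_zero_iff)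
    qed
    have wrap: "wrap s u \<in> torus s" for u
      using pos by (simp add: wrap_def torus_def)
    have wrap_add: "wrap s (wrap s u + u') = wrap s (u + u')" for u u'
      by (simp add: wrap_def vec_eq_iff mod_add_left_eq)
    let ?x = "\<lambda>u. x (wrap s u)"
    have "?x \<in> UNIV \<rightarrow> inputs L" using x wrap by auto
    from F[OF this] have "grid_view (\<lambda>w. (?x w, F (grid_view ?x w T))) v (radius L) \<in> patterns L"
      by (simp add: grid_coloring_def)
    also have "grid_view (\<lambda>w. (?x w, F (grid_view ?x w T))) v (radius L) =
      torus_view s (\<lambda>w. (x w, A n (torus_view s (\<lambda>w. (ident w, x w)) w T))) v (radius L)"
      unfolding grid_view_def[of "\<lambda>w. (_ w, _ w)"] torus_view_def[of s "\<lambda>w. (_ w, _ w)" v]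
    proof (rule restrict_ext)
      fix u :: "int ^ 'd"
      have "A n (torus_view s (\<lambda>w. (ident w, x w)) (wrap s (v + u)) T) = F (grid_view ?x (v + u) T)"
        unfolding A_def grid_view_def
        by (rule arg_cong[of _ _ F], rule restrict_ext) (simp add: torus_view_def wrap_add)
      then show "(?x (v + u), F (grid_view ?x (v + u) T)) = (x (wrap s (v + u)),
          A n (torus_view s (\<lambda>w. (ident w, x w)) (wrap s (v + u)) T))" by simp
    qed
    finally show "torus_view s (\<lambda>w. (x w, A n (torus_view s (\<lambda>w. (ident w, x w)) w T))) v (radius L)
      \<in> patterns L" .
  qed
  ultimately show ?thesis using lcl by (auto simp: LOCAL_def)
qed

text \<open>Without inputs all views coincide, so the rule takes a single value.\<close>

lemma identifier_free_rule_imp_trivial: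
  fixes L :: "('a, 'b, 'd::finite) lcl"
  assumes lcl: "is_lcl L" and no_inputs: "in_labels L = {}"
    and F: "\<And>x. x \<in> UNIV \<rightarrow> inputs L \<Longrightarrow> grid_coloring L x (\<lambda>v. F (grid_view x v T))"
  shows "trivial_lcl L"
proof -
  let ?\<alpha> = "F (\<lambda>u\<in>grid_ball 0 T. None)"
  have "grid_coloring L (\<lambda>_. None) (\<lambda>v. F (grid_view (\<lambda>_. None) v T))"
    by (rule F) (simp add: inputs_def no_inputs)
  then have col: "grid_coloring L (\<lambda>_. None) (\<lambda>_. ?\<alpha>)"
    by (simp add: grid_view_def)
  moreover have "?\<alpha> \<in> out_labels L"
    by (rule grid_coloring_out_labels[OF lcl col])
  ultimately show ?thesis unfolding trivial_lcl_def by blast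
qed

theorem corollary3p2:
  fixes L :: "('a, 'b, 'd::finite) lcl"
  assumes "is_lcl L"
    and "L \<in> ULOCAL_o (\<lambda>\<epsilon>. real (log_star (1 / \<epsilon>)))"
  shows "L \<in> LOCAL_O (\<lambda>_. 1) \<and> (in_labels L = {} \<longrightarrow> trivial_lcl L)"
proof -
  let ?g = "\<lambda>\<epsilon>. real (log_star (1 / \<epsilon>))"
  obtain t A where t: "(\<lambda>\<epsilon>. real (t \<epsilon>)) \<in> o[at_right 0](?g)"
    and A: "is_ulocal_alg L A" "ulocal_solves L A" "uniform_complexity L A t"
    using assms(2) by (auto simp: ULOCAL_o_def ULOCAL_def)
  \<comment> \<open>\<open>K\<close> is the slope and \<open>K'\<close> the constant term of the
    tower height as a function of the radius.\<close>
  define K where "K = 2 + 2 * CARD('d)"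
  define K' where "K' = 2 * radius L + CARD('d) + card (inputs L) +
      card (out_labels L) + 19 + CARD('d) * (2 * radius L + 10)"
  \<comment> \<open>Half of the log-star pays for \<open>K * t \<epsilon>\<close>, the other half
    for \<open>K'\<close> with 1 to spare, which makes the inequality strict.\<close>
  have "\<forall>\<^sub>F \<epsilon> in at_right 0. norm (real (t \<epsilon>)) \<le> 1 / (2 * real K) * norm (?g \<epsilon>)"
    by (rule landau_o.smallD[OF t]) (simp add: K_def)
  moreover have "\<forall>\<^sub>F \<epsilon> in at_right 0. 2 * real K' + 2 \<le> ?g \<epsilon>"
    using filterlim_log_star unfolding filterlim_at_top by blast
  moreover have "\<forall>\<^sub>F \<epsilon> in at_right (0 :: real). 0 < \<epsilon>"
    by (rule eventually_at_right_less)
  moreover have "\<forall>\<^sub>F \<epsilon> in at_right 0. \<forall>v. prob_radius_greater L A v (t \<epsilon>) \<le> \<epsilon>"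
    using A(3) by (simp add: uniform_complexity_def)
  ultimately have "\<forall>\<^sub>F \<epsilon> in at_right 0. 0 < \<epsilon> \<and> (\<forall>v. prob_radius_greater L A v (t \<epsilon>) \<le> \<epsilon>) \<and>
      real (twr (K * t \<epsilon> + K')) < 1 / \<epsilon>"
  proof eventually_elim
    case (elim \<epsilon>)
    have "2 * (real K * real (t \<epsilon>)) \<le> ?g \<epsilon>"
      using elim(1) by (simp add: K_def field_simps)
    then have "real (K * t \<epsilon> + K') < ?g \<epsilon>" using elim(2) by simp
    then have "real (twr (K * t \<epsilon> + K')) < 1 / \<epsilon>"
      using le_twr_imp_log_star_le[of "1 / \<epsilon>" "K * t \<epsilon> + K'"] by (meson not_le of_nat_less_iff)
    with elim show ?case by blast
  qed
  \<comment> \<open>One such \<open>\<epsilon>\<close> suffices: \<open>t \<epsilon>\<close> is then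
    a constant radius, independent of the size of the torus.\<close>
  then obtain \<epsilon> where "0 < \<epsilon>" "\<And>v. prob_radius_greater L A v (t \<epsilon>) \<le> \<epsilon>"
    "real (twr (K * t \<epsilon> + K')) < 1 / \<epsilon>"
    using eventually_happens'[OF trivial_limit_at_right_real] by blast
  then obtain F where F: "\<And>x. x \<in> UNIV \<rightarrow> inputs L \<Longrightarrow>
      grid_coloring L x (\<lambda>v. F (grid_view x v (t \<epsilon>)))"
    using exists_identifier_free_rule[OF assms(1) A(1,2), of "t \<epsilon>" \<epsilon>]
    unfolding K_def K'_def by blast
  have "L \<in> LOCAL_O (\<lambda>_. 1)"
    unfolding LOCAL_O_def
  proof (rule UN_I)
    show "(\<lambda>_. t \<epsilon>) \<in> {f. (\<lambda>n. real (f n)) \<in> O(\<lambda>_. 1)}" by simp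
    show "L \<in> LOCAL (\<lambda>_. t \<epsilon>)" by (rule identifier_free_rule_imp_LOCAL[OF assms(1) F])
  qed
  then show ?thesis
    using identifier_free_rule_imp_trivial[OF assms(1) _ F] by blast
qed

end
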